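(* Let $H$ be a Hopf algebra over $\mathbb{C}$ with invertible antipode and let $A$ be a left $H$-module algebra. Then every (right-left) SAYD module over $H$ is an ${}_AH$-SAYD module.
   Context: Work over $\mathbb{C}$. $S$ is the antipode and $\varepsilon$ the counit of $H$. Sweedler notation: $\Delta(h)=h^{(1)}\otimes h^{(2)}$ and similarly for iterated coproducts; left coactions $\blacktriangledown$ are written $m\mapsto m_{\langle -1\rangle}\otimes m_{\langle 0\rangle}$. A left $H$-module algebra is a unital algebra $A$ with a left $H$-action such that $h(ab)=(h^{(1)}a)(h^{(2)}b)$ and $h1=\varepsilon(h)1$. $H$ acts diagonally on $A^{\otimes n}$. A right-left SAYD (stable anti Yetter–Drinfeld) module over $H$ is a vector space $M$ that is a right $H$-module and left $H$-comodule with $\blacktriangledown(mh)=S(h^{(3)})m_{\langle -1\rangle}h^{(1)}\otimes m_{\langle 0\rangle}h^{(2)}$ and $m_{\langle 0\rangle}m_{\langle -1\rangle}=m$ for all $m\in M$, $h\in H$. For a right $H$-module and left $H$-comodule $M$, $M\otimes A^{\otimes(n+1)}$ is a right $H$-module via $(m\otimes\tilde a)h=mh^{(1)}\otimes S(h^{(2)})\tilde a$, $\mathbb{C}$ is a right $H$-module via $rh=\varepsilon(h)r$, and $C^n_H(A,M)=\mathrm{Hom}_H(M\otimes A^{\otimes(n+1)},\mathbb{C})$. ${}_AH$-SAYD module: a right $H$-module and left $H$-comodule $M$ such that for all $m\in M$, $h\in H$, $a\in A$, $n\ge0$, $\tilde a\in A^{\otimes(n+1)}$ and $\varphi\in C^n_H(A,M)$: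 (i) $S^{-1}((mh)_{\langle -1\rangle})a\otimes(mh)_{\langle 0\rangle}=S^{-1}(m_{\langle -1\rangle}h^{(1)})h^{(3)}a\otimes m_{\langle 0\rangle}h^{(2)}$; (ii) $\varphi(m_{\langle 0\rangle}\otimes S^{-1}(m_{\langle -1\rangle})\tilde a)=\varphi(m\otimes\tilde a)$ (diagonal action). *)

theory Defs
  imports Complex_Main "HOL-Library.Poly_Mapping"
begin

section \<open>Complex vector spaces and algebras\<close>

class scaleC =
  fixes scaleC :: "complex \<Rightarrow> 'a \<Rightarrow> 'a"  (infixr \<open>*\<^sub>C\<close> 75)

class complex_vector = scaleC + ab_group_add +
  assumes scaleC_add_right: "c *\<^sub>C (x + y) = c *\<^sub>C x + c *\<^sub>C y"
    and scaleC_add_left: "(c + d) *\<^sub>C x = c *\<^sub>C x + d *\<^sub>C x"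
    and scaleC_scaleC: "c *\<^sub>C (d *\<^sub>C x) = (c * d) *\<^sub>C x"
    and scaleC_one: "1 *\<^sub>C x = x"

global_interpretation cvec: vector_space "scaleC :: complex \<Rightarrow> 'a \<Rightarrow> 'a::complex_vector"
  by unfold_locales (simp_all add: scaleC_add_right scaleC_add_left scaleC_scaleC scaleC_one)

abbreviation cspan :: "'a::complex_vector set \<Rightarrow> 'a set"
  where "cspan \<equiv> module.span scaleC"

abbreviation clinear :: "('a::complex_vector \<Rightarrow> 'b::complex_vector) \<Rightarrow> bool"
  where "clinear \<equiv> Vector_Spaces.linear scaleC scaleC"

definition cbilinear :: "('a::complex_vector \<Rightarrow> 'b::complex_vector \<Rightarrow> 'c::complex_vector) \<Rightarrow> bool"
  where "cbilinear f \<longleftrightarrow> (\<forall>x. clinear (f x)) \<and> (\<forall>y. clinear (\<lambda>x. f x y))"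

lemma clinearI:
  fixes f :: "'a::complex_vector \<Rightarrow> 'b::complex_vector"
  assumes "\<And>x y. f (x + y) = f x + f y" "\<And>c x. f (c *\<^sub>C x) = c *\<^sub>C f x"
  shows "clinear f"
  by unfold_locales (simp_all add: assms)

lemma clinear_add: "clinear f \<Longrightarrow> f (x + y) = f x + f y"
  by (simp add: Vector_Spaces.linear_iff)

lemma clinear_scaleC: "clinear f \<Longrightarrow> f (c *\<^sub>C x) = c *\<^sub>C f x"
  by (simp add: Vector_Spaces.linear_iff)

lemma clinear_0: "clinear f \<Longrightarrow> f 0 = 0"
  using clinear_scaleC[of f 0 0] by simp

lemma clinear_diff: "clinear f \<Longrightarrow> f (x - y) = f x - f y"
  by (metis add_diff_cancel clinear_add diff_add_cancel)

lemma clinear_sum: "clinear f \<Longrightarrow> f (\<Sum>x\<in>X. g x) = (\<Sum>x\<in>X. f (g x))"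
  by (induction X rule: infinite_finite_induct) (auto simp: clinear_add clinear_0)

lemma clinear_id: "clinear (\<lambda>x. x)"
  by (rule clinearI) auto

lemma clinear_compose: "clinear f \<Longrightarrow> clinear g \<Longrightarrow> clinear (\<lambda>x. g (f x))"
  by (rule clinearI) (auto simp: clinear_add clinear_scaleC)

lemma cbilinearI:
  assumes "\<And>x y z. f (x + y) z = f x z + f y z" "\<And>c x z. f (c *\<^sub>C x) z = c *\<^sub>C f x z"
    "\<And>x y z. f x (y + z) = f x y + f x z" "\<And>c x z. f x (c *\<^sub>C z) = c *\<^sub>C f x z"
  shows "cbilinear f"
  unfolding cbilinear_def by (auto intro!: clinearI simp: assms)

lemma cbilinearD:
  assumes "cbilinear f"
  shows "clinear (f x)" "clinear (\<lambda>x. f x y)"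
    "f (x + x') y = f x y + f x' y" "f (c *\<^sub>C x) y = c *\<^sub>C f x y"
    "f x (y + y') = f x y + f x y'" "f x (c *\<^sub>C y) = c *\<^sub>C f x y"
proof -
  show 1: "clinear (f x)" and 2: "clinear (\<lambda>x. f x y)" for x y
    using assms by (auto simp: cbilinear_def)
  show "f (x + x') y = f x y + f x' y" "f (c *\<^sub>C x) y = c *\<^sub>C f x y"
    using clinear_add[OF 2] clinear_scaleC[OF 2] by blast+
  show "f x (y + y') = f x y + f x y'" "f x (c *\<^sub>C y) = c *\<^sub>C f x y"
    using clinear_add[OF 1] clinear_scaleC[OF 1] by blast+
qed

text \<open>Associative algebras with unit. Unlike \<open>ring_1\<close>, the class does not require
  \<open>0 \<noteq> 1\<close>, so that the zero algebra is included.\<close>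

class complex_unital_algebra = complex_vector + ring + monoid_mult +
  assumes mult_scaleC_left: "(c *\<^sub>C x) * y = c *\<^sub>C (x * y)"
    and mult_scaleC_right: "x * (c *\<^sub>C y) = c *\<^sub>C (x * y)"

instantiation complex :: complex_unital_algebra
begin
definition scaleC_complex :: "complex \<Rightarrow> complex \<Rightarrow> complex"
  where "scaleC_complex c x = c * x"
instance
  by standard (simp_all add: scaleC_complex_def algebra_simps)
end


section \<open>Free vector spaces\<close>

instantiation poly_mapping :: (type, complex_vector) complex_vector
begin

lift_definition scaleC_poly_mapping :: "complex \<Rightarrow> ('a \<Rightarrow>\<^sub>0 'b) \<Rightarrow> ('a \<Rightarrow>\<^sub>0 'b)"
  is "\<lambda>c f x. c *\<^sub>C f x"
proof -
  fix c :: complex and f :: "'a \<Rightarrow> 'b"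
  assume "finite {x. f x \<noteq> 0}"
  then show "finite {x. c *\<^sub>C f x \<noteq> 0}"
    by (rule rev_finite_subset) auto
qed

instance
  by standard (transfer; simp add: fun_eq_iff scaleC_add_right scaleC_add_left scaleC_scaleC scaleC_one)+

end

lemma lookup_scaleC: "Poly_Mapping.lookup (c *\<^sub>C p) x = c *\<^sub>C Poly_Mapping.lookup p x"
  by (simp add: scaleC_poly_mapping.rep_eq)

abbreviation free_gen :: "'x \<Rightarrow> 'x \<Rightarrow>\<^sub>0 complex"
  where "free_gen x \<equiv> Poly_Mapping.single x 1"

definition free_ext :: "('x \<Rightarrow> 'c::complex_vector) \<Rightarrow> ('x \<Rightarrow>\<^sub>0 complex) \<Rightarrow> 'c"
  where "free_ext f p = (\<Sum>x\<in>Poly_Mapping.keys p. Poly_Mapping.lookup p x *\<^sub>C f x)"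

lemma free_ext_superset:
  assumes "finite X" "Poly_Mapping.keys p \<subseteq> X"
  shows "free_ext f p = (\<Sum>x\<in>X. Poly_Mapping.lookup p x *\<^sub>C f x)"
  unfolding free_ext_def using assms
  by (intro sum.mono_neutral_left) (auto simp: in_keys_iff)

lemma clinear_free_ext: "clinear (free_ext f)"
proof (rule clinearI)
  fix p q :: "'a \<Rightarrow>\<^sub>0 complex"
  let ?X = "Poly_Mapping.keys p \<union> Poly_Mapping.keys q"
  have "free_ext f (p + q) = (\<Sum>x\<in>?X. Poly_Mapping.lookup (p + q) x *\<^sub>C f x)"
    by (rule free_ext_superset) (auto simp: Poly_Mapping.keys_add)
  also have "\<dots> = free_ext f p + free_ext f q"
    by (simp add: free_ext_superset[of ?X] lookup_add scaleC_add_left sum.distrib)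
  finally show "free_ext f (p + q) = free_ext f p + free_ext f q" .
next
  fix c and p :: "'a \<Rightarrow>\<^sub>0 complex"
  have "free_ext f (c *\<^sub>C p) = (\<Sum>x\<in>Poly_Mapping.keys p. Poly_Mapping.lookup (c *\<^sub>C p) x *\<^sub>C f x)"
    by (rule free_ext_superset) (auto simp: in_keys_iff lookup_scaleC)
  also have "\<dots> = c *\<^sub>C free_ext f p"
    by (simp add: free_ext_def lookup_scaleC scaleC_complex_def cvec.scale_sum_right)
  finally show "free_ext f (c *\<^sub>C p) = c *\<^sub>C free_ext f p" .
qed

lemma free_ext_gen: "free_ext f (free_gen x) = f x"
  by (simp add: free_ext_def)

lemma free_ext_id: "free_ext free_gen p = p"
proof (rule poly_mapping_eqI)
  fix k
  show "Poly_Mapping.lookup (free_ext free_gen p) k = Poly_Mapping.lookup p k"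
    by (auto simp: free_ext_def lookup_sum lookup_scaleC lookup_single scaleC_complex_def
        when_def in_keys_iff if_distrib cong: if_cong)
qed

lemma free_ext_unique:
  assumes "clinear g"
  shows "g p = free_ext (\<lambda>x. g (free_gen x)) p"
proof -
  have "g p = g (free_ext free_gen p)"
    by (simp add: free_ext_id)
  also have "\<dots> = free_ext (\<lambda>x. g (free_gen x)) p"
    by (simp add: free_ext_def clinear_sum[OF assms] clinear_scaleC[OF assms])
  finally show ?thesis .
qed

lemma clinear_zero_on_cspan:
  assumes "clinear g" "\<And>x. x \<in> X \<Longrightarrow> g x = 0" "x \<in> cspan X"
  shows "g x = 0"
  using assms(3)
  by (induction rule: cvec.span_induct_alt)
     (auto simp: assms(2) clinear_0[OF assms(1)] clinear_add[OF assms(1)] clinear_scaleC[OF assms(1)])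


section \<open>The tensor product of two vector spaces\<close>

definition tensor_null :: "('a::complex_vector \<times> 'b::complex_vector \<Rightarrow>\<^sub>0 complex) set"
  where "tensor_null = cspan
    ({free_gen (x + x', y) - free_gen (x, y) - free_gen (x', y) | x x' y. True} \<union>
     {free_gen (x, y + y') - free_gen (x, y) - free_gen (x, y') | x y y'. True} \<union>
     {free_gen (c *\<^sub>C x, y) - c *\<^sub>C free_gen (x, y) | c x y. True} \<union>
     {free_gen (x, c *\<^sub>C y) - c *\<^sub>C free_gen (x, y) | c x y. True})"

lemma cong_mod_cspan_equivp: "equivp (\<lambda>p q. p - q \<in> cspan X)"
proof (rule equivpI)
  show "reflp (\<lambda>p q. p - q \<in> cspan X)"
    by (simp add: reflp_def cvec.span_zero)
  show "symp (\<lambda>p q. p - q \<in> cspan X)"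
    by (metis (no_types, lifting) cvec.span_neg minus_diff_eq sympI)
  show "transp (\<lambda>p q. p - q \<in> cspan X)"
  proof (rule transpI)
    fix x y z assume "x - y \<in> cspan X" "y - z \<in> cspan X"
    then show "x - z \<in> cspan X"
      using cvec.span_add[of "x - y" X "y - z"] by simp
  qed
qed

lemma cong_mod_cspan_add:
  "p - p' \<in> cspan X \<Longrightarrow> q - q' \<in> cspan X \<Longrightarrow> (p + q) - (p' + q') \<in> cspan X"
  using cvec.span_add[of "p - p'" X "q - q'"] by (simp add: algebra_simps)

lemma cong_mod_cspan_diff:
  "p - p' \<in> cspan X \<Longrightarrow> q - q' \<in> cspan X \<Longrightarrow> (p - q) - (p' - q') \<in> cspan X"
  using cvec.span_diff[of "p - p'" X "q - q'"] by (simp add: algebra_simps)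

lemma cong_mod_cspan_neg:
  "p - p' \<in> cspan X \<Longrightarrow> (- p) - (- p') \<in> cspan X"
  using cvec.span_neg[of "p - p'" X] by (simp add: algebra_simps)

lemma cong_mod_cspan_scaleC:
  "p - p' \<in> cspan X \<Longrightarrow> c *\<^sub>C p - c *\<^sub>C p' \<in> cspan X"
  using cvec.span_scale[of "p - p'" X c] by (simp add: cvec.scale_right_diff_distrib)

quotient_type (overloaded) ('a, 'b) tensor (infixr \<open>\<otimes>\<close> 75) =
  "'a::complex_vector \<times> 'b::complex_vector \<Rightarrow>\<^sub>0 complex" / "\<lambda>p q. p - q \<in> tensor_null"
  unfolding tensor_null_def by (rule cong_mod_cspan_equivp)

instantiation tensor :: (complex_vector, complex_vector) complex_vector
begin
lift_definition zero_tensor :: "'a \<otimes> 'b" is 0 .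
lift_definition plus_tensor :: "'a \<otimes> 'b \<Rightarrow> 'a \<otimes> 'b \<Rightarrow> 'a \<otimes> 'b" is "(+)"
  unfolding tensor_null_def by (rule cong_mod_cspan_add)
lift_definition minus_tensor :: "'a \<otimes> 'b \<Rightarrow> 'a \<otimes> 'b \<Rightarrow> 'a \<otimes> 'b" is "(-)"
  unfolding tensor_null_def by (rule cong_mod_cspan_diff)
lift_definition uminus_tensor :: "'a \<otimes> 'b \<Rightarrow> 'a \<otimes> 'b" is "uminus"
  unfolding tensor_null_def by (rule cong_mod_cspan_neg)
lift_definition scaleC_tensor :: "complex \<Rightarrow> 'a \<otimes> 'b \<Rightarrow> 'a \<otimes> 'b" is "scaleC"
  unfolding tensor_null_def by (rule cong_mod_cspan_scaleC)
instance
  by standard (transfer; simp add: algebra_simps tensor_null_def cvec.span_zero)+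
end

lift_definition tensor :: "'a::complex_vector \<Rightarrow> 'b::complex_vector \<Rightarrow> 'a \<otimes> 'b" (infixr \<open>\<otimes>\<close> 75)
  is "\<lambda>x y. free_gen (x, y)" .

text \<open>The linear map on the tensor product induced by a bilinear map \<open>f\<close>; with the
  Sweedler notation \<open>t = t\<^sup>1 \<otimes> t\<^sup>2\<close>, \<open>tensor_lift f t\<close> is \<open>f t\<^sup>1 t\<^sup>2\<close>.
  It is only meaningful for bilinear \<open>f\<close>.\<close>

definition tensor_lift ::
    "('a::complex_vector \<Rightarrow> 'b::complex_vector \<Rightarrow> 'c::complex_vector) \<Rightarrow> 'a \<otimes> 'b \<Rightarrow> 'c"
  where "tensor_lift f = (THE g. clinear g \<and> (\<forall>x y. g (x \<otimes> y) = f x y))"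

lemma cbilinear_tensor: "cbilinear (\<otimes>)"
proof (rule cbilinearI)
  fix c and x y :: 'a and z u :: 'b
  show "(x + y) \<otimes> z = x \<otimes> z + y \<otimes> z"
    by (transfer, unfold tensor_null_def, unfold diff_diff_eq[symmetric], rule cvec.span_base) blast
  show "(c *\<^sub>C x) \<otimes> z = c *\<^sub>C (x \<otimes> z)"
    by (transfer, unfold tensor_null_def, rule cvec.span_base) blast
  show "x \<otimes> (z + u) = x \<otimes> z + x \<otimes> u"
    by (transfer, unfold tensor_null_def, unfold diff_diff_eq[symmetric], rule cvec.span_base) blast
  show "x \<otimes> (c *\<^sub>C z) = c *\<^sub>C (x \<otimes> z)"
    by (transfer, unfold tensor_null_def, rule cvec.span_base) blast
qed

lemmas tensor_simps = cbilinearD(3-6)[OF cbilinear_tensor]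

lemma clinear_abs_tensor: "clinear abs_tensor"
  by (rule clinearI) (simp_all add: plus_tensor.abs_eq scaleC_tensor.abs_eq)

lemma tensor_clinear_eqI:
  fixes g h :: "'a::complex_vector \<otimes> 'b::complex_vector \<Rightarrow> 'c::complex_vector"
  assumes "clinear g" "clinear h" "\<And>x y. g (x \<otimes> y) = h (x \<otimes> y)"
  shows "g = h"
proof
  fix t :: "'a \<otimes> 'b"
  obtain p where t: "t = abs_tensor p"
    using Quotient_abs_rep[OF Quotient_tensor] by metis
  have "g (abs_tensor p) = h (abs_tensor p)"
    using free_ext_unique[OF clinear_compose[OF clinear_abs_tensor assms(1)], of p]
      free_ext_unique[OF clinear_compose[OF clinear_abs_tensor assms(2)], of p]
      assms(3) by (simp add: tensor.abs_eq free_ext_def split_paired_all)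
  then show "g t = h t"
    by (simp add: t)
qed

lemma tensor_lift_exists:
  fixes f :: "'a::complex_vector \<Rightarrow> 'b::complex_vector \<Rightarrow> 'c::complex_vector"
  assumes "cbilinear f"
  shows "\<exists>g. clinear g \<and> (\<forall>x y. g (x \<otimes> y) = f x y)"
proof -
  let ?F = "free_ext (\<lambda>(x, y). f x y)"
  have null: "?F p = 0" if "p \<in> tensor_null" for p
    by (rule clinear_zero_on_cspan[OF clinear_free_ext _ that[unfolded tensor_null_def]])
       (elim UnE CollectE exE conjE;
        simp add: clinear_diff[OF clinear_free_ext] clinear_scaleC[OF clinear_free_ext]
          free_ext_gen cbilinearD(3-6)[OF assms])
  have eq: "?F (rep_tensor (abs_tensor p)) = ?F p" for p
  proof -
    have "rep_tensor (abs_tensor p) - p \<in> tensor_null"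
      by (rule Quotient_rep_abs[OF Quotient_tensor]) (simp add: tensor_null_def cvec.span_zero)
    from null[OF this] show ?thesis
      by (simp add: clinear_diff[OF clinear_free_ext])
  qed
  have abs: "\<exists>p. t = abs_tensor p" for t :: "'a \<otimes> 'b"
    using Quotient_abs_rep[OF Quotient_tensor] by metis
  have "clinear (\<lambda>t. ?F (rep_tensor t))"
  proof (rule clinearI)
    fix c and s t :: "'a \<otimes> 'b"
    obtain p q where pq: "s = abs_tensor p" "t = abs_tensor q"
      using abs by blast
    show "?F (rep_tensor (s + t)) = ?F (rep_tensor s) + ?F (rep_tensor t)"
      by (simp add: pq plus_tensor.abs_eq eq clinear_add[OF clinear_free_ext])
    show "?F (rep_tensor (c *\<^sub>C s)) = c *\<^sub>C ?F (rep_tensor s)"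
      by (simp add: pq scaleC_tensor.abs_eq eq clinear_scaleC[OF clinear_free_ext])
  qed
  moreover have "?F (rep_tensor (x \<otimes> y)) = f x y" for x y
    by (simp add: tensor.abs_eq eq free_ext_gen)
  ultimately show ?thesis
    by blast
qed

lemma tensor_lift_clinear_and_tensor:
  assumes "cbilinear f"
  shows "clinear (tensor_lift f) \<and> (\<forall>x y. tensor_lift f (x \<otimes> y) = f x y)"
proof -
  have "\<exists>!g. clinear g \<and> (\<forall>x y. g (x \<otimes> y) = f x y)"
    using tensor_lift_exists[OF assms] by (metis tensor_clinear_eqI)
  then show ?thesis
    unfolding tensor_lift_def by (rule theI')
qed

lemma clinear_tensor_lift: "cbilinear f \<Longrightarrow> clinear (tensor_lift f)"
  and tensor_lift_tensor: "cbilinear f \<Longrightarrow> tensor_lift f (x \<otimes> y) = f x y"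
  using tensor_lift_clinear_and_tensor by blast+

lemma tensor_lift_unique:
  assumes "clinear g"
  shows "tensor_lift (\<lambda>x y. g (x \<otimes> y)) = g"
proof -
  have "cbilinear (\<lambda>x y. g (x \<otimes> y))"
    by (rule cbilinearI) (simp_all add: tensor_simps clinear_add[OF assms] clinear_scaleC[OF assms])
  then show ?thesis
    by (intro tensor_clinear_eqI clinear_tensor_lift assms) (simp_all add: tensor_lift_tensor)
qed

lemma tensor_induct [case_names tensor add]:
  fixes P :: "'a::complex_vector \<otimes> 'b::complex_vector \<Rightarrow> bool"
  assumes "\<And>x y. P (x \<otimes> y)" "\<And>s t. P s \<Longrightarrow> P t \<Longrightarrow> P (s + t)"
  shows "P t"
proof -
  obtain p where t: "t = abs_tensor p"
    using Quotient_abs_rep[OF Quotient_tensor] by metis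
  have zero: "P 0"
    using assms(1)[of 0 0] tensor_simps(2)[of 0 "0::'a" "0::'b"] by simp
  have pure: "P (abs_tensor (c *\<^sub>C free_gen k))" for c k
  proof -
    have "abs_tensor (c *\<^sub>C free_gen k) = (c *\<^sub>C fst k) \<otimes> snd k"
      using tensor_simps(2)[of c "fst k" "snd k"]
      by (simp add: clinear_scaleC[OF clinear_abs_tensor] tensor.abs_eq)
    then show ?thesis
      by (simp only: assms(1))
  qed
  have "P (\<Sum>k\<in>X. abs_tensor (Poly_Mapping.lookup p k *\<^sub>C free_gen k))" for X
    by (induction X rule: infinite_finite_induct) (auto intro: zero pure assms(2))
  then have "P (abs_tensor (free_ext free_gen p))"
    by (simp add: free_ext_def clinear_sum[OF clinear_abs_tensor])
  then show ?thesis
    by (simp add: t free_ext_id)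
qed

definition tensor_map ::
    "('a::complex_vector \<Rightarrow> 'c::complex_vector) \<Rightarrow> ('b::complex_vector \<Rightarrow> 'd::complex_vector)
      \<Rightarrow> 'a \<otimes> 'b \<Rightarrow> 'c \<otimes> 'd"
  where "tensor_map f g = tensor_lift (\<lambda>x y. f x \<otimes> g y)"

definition tensor_assoc ::
    "('a::complex_vector \<otimes> 'b::complex_vector) \<otimes> 'c::complex_vector \<Rightarrow> 'a \<otimes> 'b \<otimes> 'c"
  where "tensor_assoc = tensor_lift (\<lambda>s z. tensor_lift (\<lambda>x y. x \<otimes> y \<otimes> z) s)"

instantiation tensor :: (complex_unital_algebra, complex_unital_algebra) complex_unital_algebra
begin

definition one_tensor :: "'a \<otimes> 'b"
  where "one_tensor = 1 \<otimes> 1"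

definition times_tensor :: "'a \<otimes> 'b \<Rightarrow> 'a \<otimes> 'b \<Rightarrow> 'a \<otimes> 'b"
  where "times_tensor s t =
    tensor_lift (\<lambda>a b. tensor_lift (\<lambda>a' b'. (a * a') \<otimes> (b * b')) t) s"

instance
proof -
  have inner: "cbilinear (\<lambda>a' b'. (a * a') \<otimes> (b * b'))" for a :: 'a and b :: 'b
    by (rule cbilinearI) (simp_all add: tensor_simps distrib_left mult_scaleC_right)
  have inner_eq: "tensor_lift (\<lambda>a' b'. (a * a') \<otimes> (b * b')) (x \<otimes> y) = (a * x) \<otimes> (b * y)"
    for a x :: 'a and b y :: 'b
    by (rule tensor_lift_tensor[OF inner])
  note inner_add = clinear_add[OF clinear_tensor_lift[OF inner]]
  note inner_scaleC = clinear_scaleC[OF clinear_tensor_lift[OF inner]]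
  have outer: "cbilinear (\<lambda>a b. tensor_lift (\<lambda>a' b'. (a * a') \<otimes> (b * b')) t)" for t :: "'a \<otimes> 'b"
  proof (induction t rule: tensor_induct)
    case (tensor x y)
    show ?case
      unfolding inner_eq
      by (rule cbilinearI) (simp_all add: tensor_simps distrib_right mult_scaleC_left)
  next
    case (add s t)
    show ?case
      by (rule cbilinearI)
        (simp_all add: inner_add cbilinearD(3-6)[OF add.IH(1)] cbilinearD(3-6)[OF add.IH(2)]
          scaleC_add_right)
  qed
  have mult_tensor: "(a \<otimes> b) * t = tensor_lift (\<lambda>a' b'. (a * a') \<otimes> (b * b')) t"
    for a :: 'a and b :: 'b and t
    unfolding times_tensor_def by (rule tensor_lift_tensor[OF outer])
  have mult: "(a \<otimes> b) * (c \<otimes> d) = (a * c) \<otimes> (b * d)" for a c :: 'a and b d :: 'b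
    by (simp add: mult_tensor inner_eq)
  have distr: "(s + s') * t = s * t + s' * t" for s s' t :: "'a \<otimes> 'b"
    unfolding times_tensor_def by (rule clinear_add[OF clinear_tensor_lift[OF outer]])
  have scl: "(c *\<^sub>C s) * t = c *\<^sub>C (s * t)" for c and s t :: "'a \<otimes> 'b"
    unfolding times_tensor_def by (rule clinear_scaleC[OF clinear_tensor_lift[OF outer]])
  have distl: "s * (t + t') = s * t + s * t'" for s t t' :: "'a \<otimes> 'b"
    by (induction s rule: tensor_induct) (simp_all add: mult_tensor inner_add distr)
  have scr: "s * (c *\<^sub>C t) = c *\<^sub>C (s * t)" for c and s t :: "'a \<otimes> 'b"
    by (induction s rule: tensor_induct)
      (simp_all add: mult_tensor inner_scaleC distr scaleC_add_right)
  have assoc1: "((a \<otimes> b) * (c \<otimes> d)) * u = (a \<otimes> b) * ((c \<otimes> d) * u)"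
    for a c :: 'a and b d :: 'b and u
    by (induction u rule: tensor_induct) (simp_all add: mult distl mult.assoc)
  have assoc2: "((a \<otimes> b) * t) * u = (a \<otimes> b) * (t * u)" for a :: 'a and b :: 'b and t u
    by (induction t rule: tensor_induct) (simp_all add: assoc1 distl distr)
  have assoc: "(s * t) * u = s * (t * u)" for s t u :: "'a \<otimes> 'b"
    by (induction s rule: tensor_induct) (simp_all add: assoc2 distr)
  have "1 * t = t" "t * 1 = t" for t :: "'a \<otimes> 'b"
    by (induction t rule: tensor_induct; simp add: one_tensor_def mult distl distr)+
  then show "OFCLASS('a \<otimes> 'b, complex_unital_algebra_class)"
    using assoc distl distr scl scr by intro_classes auto
qed

end


section \<open>Tensor powers\<close>

text \<open>The powers \<open>A\<^bsup>\<otimes>n\<^esup>\<close> are realised simultaneously as the homogeneous components of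
  \<open>T(A)\<close>: the free vector space on all words in \<open>A\<close> modulo multilinearity in each letter.
  Since the relations only involve words of the same length, the words of length \<open>n\<close>
  span a copy of \<open>A\<^bsup>\<otimes>n\<^esup>\<close>.\<close>

definition tensor_words_null :: "('a::complex_vector list \<Rightarrow>\<^sub>0 complex) set"
  where "tensor_words_null = cspan
    ({free_gen (u @ (x + y) # v) - free_gen (u @ x # v) - free_gen (u @ y # v) | u x y v. True} \<union>
     {free_gen (u @ (c *\<^sub>C x) # v) - c *\<^sub>C free_gen (u @ x # v) | c u x v. True})"

quotient_type (overloaded) 'a tensor_words =
  "'a::complex_vector list \<Rightarrow>\<^sub>0 complex" / "\<lambda>p q. p - q \<in> tensor_words_null"
  unfolding tensor_words_null_def by (rule cong_mod_cspan_equivp)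

instantiation tensor_words :: (complex_vector) complex_vector
begin
lift_definition zero_tensor_words :: "'a tensor_words" is 0 .
lift_definition plus_tensor_words :: "'a tensor_words \<Rightarrow> 'a tensor_words \<Rightarrow> 'a tensor_words" is "(+)"
  unfolding tensor_words_null_def by (rule cong_mod_cspan_add)
lift_definition minus_tensor_words :: "'a tensor_words \<Rightarrow> 'a tensor_words \<Rightarrow> 'a tensor_words" is "(-)"
  unfolding tensor_words_null_def by (rule cong_mod_cspan_diff)
lift_definition uminus_tensor_words :: "'a tensor_words \<Rightarrow> 'a tensor_words" is "uminus"
  unfolding tensor_words_null_def by (rule cong_mod_cspan_neg)
lift_definition scaleC_tensor_words :: "complex \<Rightarrow> 'a tensor_words \<Rightarrow> 'a tensor_words" is "scaleC"
  unfolding tensor_words_null_def by (rule cong_mod_cspan_scaleC)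
instance
  by standard (transfer; simp add: algebra_simps tensor_words_null_def cvec.span_zero)+
end

text \<open>\<open>word [a\<^sub>1, \<dots>, a\<^sub>n]\<close> is the elementary tensor \<open>a\<^sub>1 \<otimes> \<dots> \<otimes> a\<^sub>n\<close>.\<close>

lift_definition word :: "'a::complex_vector list \<Rightarrow> 'a tensor_words"
  is free_gen .

definition tensor_power :: "nat \<Rightarrow> 'a::complex_vector tensor_words set"
  where "tensor_power n = cspan {word as | as. length as = n}"

definition cmultilinear :: "('a::complex_vector list \<Rightarrow> 'c::complex_vector) \<Rightarrow> bool"
  where "cmultilinear f \<longleftrightarrow> (\<forall>u v. clinear (\<lambda>x. f (u @ x # v)))"

text \<open>As for \<open>tensor_lift\<close>, the value is only meaningful for multilinear \<open>f\<close>.\<close>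

definition words_lift :: "('a::complex_vector list \<Rightarrow> 'c::complex_vector) \<Rightarrow> 'a tensor_words \<Rightarrow> 'c"
  where "words_lift f = (THE g. clinear g \<and> (\<forall>as. g (word as) = f as))"

lemma cmultilinear_word: "cmultilinear word"
  unfolding cmultilinear_def
proof (intro allI clinearI)
  fix c and u v :: "'a list" and x y
  show "word (u @ (x + y) # v) = word (u @ x # v) + word (u @ y # v)"
    by (transfer, unfold tensor_words_null_def, unfold diff_diff_eq[symmetric], rule cvec.span_base)
      blast
  show "word (u @ (c *\<^sub>C x) # v) = c *\<^sub>C word (u @ x # v)"
    by (transfer, unfold tensor_words_null_def, rule cvec.span_base) blast
qed

lemma clinear_abs_tensor_words: "clinear abs_tensor_words"
  by (rule clinearI) (simp_all add: plus_tensor_words.abs_eq scaleC_tensor_words.abs_eq)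

lemma words_clinear_eqI:
  fixes g h :: "'a::complex_vector tensor_words \<Rightarrow> 'c::complex_vector"
  assumes "clinear g" "clinear h" "\<And>as. g (word as) = h (word as)"
  shows "g = h"
proof
  fix t :: "'a tensor_words"
  obtain p where t: "t = abs_tensor_words p"
    using Quotient_abs_rep[OF Quotient_tensor_words] by metis
  have "g (abs_tensor_words p) = h (abs_tensor_words p)"
    using free_ext_unique[OF clinear_compose[OF clinear_abs_tensor_words assms(1)], of p]
      free_ext_unique[OF clinear_compose[OF clinear_abs_tensor_words assms(2)], of p]
      assms(3) by (simp add: word.abs_eq free_ext_def)
  then show "g t = h t"
    by (simp add: t)
qed

lemma words_lift_exists:
  fixes f :: "'a::complex_vector list \<Rightarrow> 'c::complex_vector"
  assumes "cmultilinear f"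
  shows "\<exists>g. clinear g \<and> (\<forall>as. g (word as) = f as)"
proof -
  let ?F = "free_ext f"
  have lin: "clinear (\<lambda>x. f (u @ x # v))" for u v
    using assms by (simp add: cmultilinear_def)
  have null: "?F p = 0" if "p \<in> tensor_words_null" for p
    by (rule clinear_zero_on_cspan[OF clinear_free_ext _ that[unfolded tensor_words_null_def]])
       (elim UnE CollectE exE conjE;
        simp add: clinear_diff[OF clinear_free_ext] clinear_scaleC[OF clinear_free_ext]
          free_ext_gen clinear_add[OF lin] clinear_scaleC[OF lin])
  have eq: "?F (rep_tensor_words (abs_tensor_words p)) = ?F p" for p
  proof -
    have "rep_tensor_words (abs_tensor_words p) - p \<in> tensor_words_null"
      by (rule Quotient_rep_abs[OF Quotient_tensor_words]) (simp add: tensor_words_null_def cvec.span_zero)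
    from null[OF this] show ?thesis
      by (simp add: clinear_diff[OF clinear_free_ext])
  qed
  have abs: "\<exists>p. t = abs_tensor_words p" for t :: "'a tensor_words"
    using Quotient_abs_rep[OF Quotient_tensor_words] by metis
  have "clinear (\<lambda>t. ?F (rep_tensor_words t))"
  proof (rule clinearI)
    fix c and s t :: "'a tensor_words"
    obtain p q where pq: "s = abs_tensor_words p" "t = abs_tensor_words q"
      using abs by blast
    show "?F (rep_tensor_words (s + t)) = ?F (rep_tensor_words s) + ?F (rep_tensor_words t)"
      by (simp add: pq plus_tensor_words.abs_eq eq clinear_add[OF clinear_free_ext])
    show "?F (rep_tensor_words (c *\<^sub>C s)) = c *\<^sub>C ?F (rep_tensor_words s)"
      by (simp add: pq scaleC_tensor_words.abs_eq eq clinear_scaleC[OF clinear_free_ext])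
  qed
  moreover have "?F (rep_tensor_words (word as)) = f as" for as
    by (simp add: word.abs_eq eq free_ext_gen)
  ultimately show ?thesis
    by blast
qed

lemma words_lift_clinear_and_word:
  assumes "cmultilinear f"
  shows "clinear (words_lift f) \<and> (\<forall>as. words_lift f (word as) = f as)"
proof -
  have "\<exists>!g. clinear g \<and> (\<forall>as. g (word as) = f as)"
    using words_lift_exists[OF assms] by (metis words_clinear_eqI)
  then show ?thesis
    unfolding words_lift_def by (rule theI')
qed

lemma clinear_words_lift: "cmultilinear f \<Longrightarrow> clinear (words_lift f)"
  and words_lift_word: "cmultilinear f \<Longrightarrow> words_lift f (word as) = f as"
  using words_lift_clinear_and_word by blast+

text \<open>\<open>a \<otimes> -\<close> as a map \<open>A\<^bsup>\<otimes>n\<^esup> \<Rightarrow> A\<^bsup>\<otimes>(n+1)\<^esup>\<close>.\<close>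

definition words_cons :: "'a::complex_vector \<Rightarrow> 'a tensor_words \<Rightarrow> 'a tensor_words"
  where "words_cons a = words_lift (\<lambda>as. word (a # as))"

lemma cmultilinear_word_Cons: "cmultilinear (\<lambda>as. word (a # as))"
  using cmultilinear_word[unfolded cmultilinear_def, rule_format, of "a # _"]
  by (simp add: cmultilinear_def)

lemma words_cons_word: "words_cons a (word as) = word (a # as)"
  unfolding words_cons_def by (rule words_lift_word[OF cmultilinear_word_Cons])


section \<open>Hopf algebras\<close>

text \<open>\<open>sweedler3 \<Delta> F h\<close> is \<open>F h\<^sup>1 h\<^sup>2 h\<^sup>3\<close> (summation understood), for trilinear \<open>F\<close>.\<close>

definition sweedler3 ::
    "('h::complex_vector \<Rightarrow> 'h \<otimes> 'h) \<Rightarrow> ('h \<Rightarrow> 'h \<Rightarrow> 'h \<Rightarrow> 'c::complex_vector) \<Rightarrow> 'h \<Rightarrow> 'c"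
  where "sweedler3 \<Delta> F h =
    tensor_lift (\<lambda>h\<^sub>1 k. tensor_lift (\<lambda>h\<^sub>2 h\<^sub>3. F h\<^sub>1 h\<^sub>2 h\<^sub>3) (\<Delta> k)) (\<Delta> h)"

locale coalgebra =
  fixes \<Delta> :: "'h::complex_vector \<Rightarrow> 'h \<otimes> 'h"
    and \<epsilon> :: "'h \<Rightarrow> complex"
  assumes comult_linear: "clinear \<Delta>"
    and counit_linear: "clinear \<epsilon>"
    and coassoc: "tensor_assoc (tensor_map \<Delta> id (\<Delta> h)) = tensor_map id \<Delta> (\<Delta> h)"
    and counit_left: "tensor_lift (\<lambda>h\<^sub>1 h\<^sub>2. \<epsilon> h\<^sub>1 *\<^sub>C h\<^sub>2) (\<Delta> h) = h"
    and counit_right: "tensor_lift (\<lambda>h\<^sub>1 h\<^sub>2. \<epsilon> h\<^sub>2 *\<^sub>C h\<^sub>1) (\<Delta> h) = h"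

locale hopf_algebra = coalgebra \<Delta> \<epsilon>
  for \<Delta> :: "'h::complex_unital_algebra \<Rightarrow> 'h \<otimes> 'h"
    and \<epsilon> :: "'h \<Rightarrow> complex"
    and S :: "'h \<Rightarrow> 'h" +
  assumes comult_mult: "\<Delta> (g * h) = \<Delta> g * \<Delta> h"
    and comult_one: "\<Delta> 1 = 1"
    and counit_mult: "\<epsilon> (g * h) = \<epsilon> g * \<epsilon> h"
    and counit_one: "\<epsilon> 1 = 1"
    and antipode_linear: "clinear S"
    and antipode_left: "tensor_lift (\<lambda>h\<^sub>1 h\<^sub>2. S h\<^sub>1 * h\<^sub>2) (\<Delta> h) = \<epsilon> h *\<^sub>C 1"
    and antipode_right: "tensor_lift (\<lambda>h\<^sub>1 h\<^sub>2. h\<^sub>1 * S h\<^sub>2) (\<Delta> h) = \<epsilon> h *\<^sub>C 1"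


section \<open>Modules and comodules\<close>

locale left_module =
  fixes act :: "'h::complex_unital_algebra \<Rightarrow> 'a::complex_vector \<Rightarrow> 'a"
  assumes act_bilinear: "cbilinear act"
    and act_mult: "act (g * h) a = act g (act h a)"
    and act_one: "act 1 a = a"

locale right_module =
  fixes ract :: "'m::complex_vector \<Rightarrow> 'h::complex_unital_algebra \<Rightarrow> 'm"
  assumes ract_bilinear: "cbilinear ract"
    and ract_mult: "ract m (g * h) = ract (ract m g) h"
    and ract_one: "ract m 1 = m"

locale left_comodule = coalgebra \<Delta> \<epsilon>
  for \<Delta> :: "'h::complex_vector \<Rightarrow> 'h \<otimes> 'h"
    and \<epsilon> :: "'h \<Rightarrow> complex"
    and coact :: "'m::complex_vector \<Rightarrow> 'h \<otimes> 'm" +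
  assumes coact_linear: "clinear coact"
    and coact_coassoc: "tensor_assoc (tensor_map \<Delta> id (coact m)) = tensor_map id coact (coact m)"
    and coact_counit: "tensor_lift (\<lambda>k n. \<epsilon> k *\<^sub>C n) (coact m) = m"

locale module_algebra = hopf_algebra \<Delta> \<epsilon> S + left_module act
  for \<Delta> :: "'h::complex_unital_algebra \<Rightarrow> 'h \<otimes> 'h"
    and \<epsilon> :: "'h \<Rightarrow> complex"
    and S :: "'h \<Rightarrow> 'h"
    and act :: "'h \<Rightarrow> 'a::complex_unital_algebra \<Rightarrow> 'a" +
  assumes act_alg_mult: "act h (a * b) = tensor_lift (\<lambda>h\<^sub>1 h\<^sub>2. act h\<^sub>1 a * act h\<^sub>2 b) (\<Delta> h)"
    and act_alg_one: "act h 1 = \<epsilon> h *\<^sub>C 1"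

locale sayd_module =
  hopf_algebra \<Delta> \<epsilon> S + right_module ract + left_comodule \<Delta> \<epsilon> coact
  for \<Delta> :: "'h::complex_unital_algebra \<Rightarrow> 'h \<otimes> 'h"
    and \<epsilon> :: "'h \<Rightarrow> complex"
    and S :: "'h \<Rightarrow> 'h"
    and ract :: "'m::complex_vector \<Rightarrow> 'h \<Rightarrow> 'm"
    and coact :: "'m \<Rightarrow> 'h \<otimes> 'm" +
  assumes anti_yetter_drinfeld:
      "coact (ract m h) =
        tensor_lift (\<lambda>k n. sweedler3 \<Delta> (\<lambda>h\<^sub>1 h\<^sub>2 h\<^sub>3. (S h\<^sub>3 * k * h\<^sub>1) \<otimes> ract n h\<^sub>2) h) (coact m)"
    and stable: "tensor_lift (\<lambda>k n. ract n k) (coact m) = m"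


section \<open>Cochains and AH-SAYD modules\<close>

text \<open>The diagonal action
  \<open>h (a\<^sub>1 \<otimes> \<dots> \<otimes> a\<^sub>n) = h\<^sup>1 a\<^sub>1 \<otimes> \<dots> \<otimes> h\<^sup>n a\<^sub>n\<close>, by recursion on \<open>n\<close>: the ground field
  \<open>A\<^bsup>\<otimes>0\<^esup>\<close> carries the trivial action, and \<open>h (a \<otimes> t) = h\<^sup>1 a \<otimes> h\<^sup>2 t\<close>.\<close>

primrec diag_act_word ::
    "('h::complex_vector \<Rightarrow> 'h \<otimes> 'h) \<Rightarrow> ('h \<Rightarrow> complex) \<Rightarrow> ('h \<Rightarrow> 'a \<Rightarrow> 'a)
      \<Rightarrow> 'a::complex_vector list \<Rightarrow> 'h \<Rightarrow> 'a tensor_words"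
  where
    "diag_act_word \<Delta> \<epsilon> act [] = (\<lambda>h. \<epsilon> h *\<^sub>C word [])"
  | "diag_act_word \<Delta> \<epsilon> act (a # as) =
      (\<lambda>h. tensor_lift (\<lambda>h\<^sub>1 h\<^sub>2. words_cons (act h\<^sub>1 a) (diag_act_word \<Delta> \<epsilon> act as h\<^sub>2)) (\<Delta> h))"

definition diag_act ::
    "('h::complex_vector \<Rightarrow> 'h \<otimes> 'h) \<Rightarrow> ('h \<Rightarrow> complex) \<Rightarrow> ('h \<Rightarrow> 'a \<Rightarrow> 'a)
      \<Rightarrow> 'h \<Rightarrow> 'a::complex_vector tensor_words \<Rightarrow> 'a tensor_words"
  where "diag_act \<Delta> \<epsilon> act h = words_lift (\<lambda>as. diag_act_word \<Delta> \<epsilon> act as h)"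

text \<open>\<open>M \<otimes> A\<^bsup>\<otimes>n\<^esup>\<close> as a subspace of \<open>M \<otimes> T(A)\<close>.\<close>

definition coeff_tensor_power ::
    "nat \<Rightarrow> ('m::complex_vector \<otimes> 'a::complex_vector tensor_words) set"
  where "coeff_tensor_power n = cspan {m \<otimes> t | m t. t \<in> tensor_power n}"

definition coeff_ract ::
    "('h::complex_vector \<Rightarrow> 'h \<otimes> 'h) \<Rightarrow> ('h \<Rightarrow> complex) \<Rightarrow> ('h \<Rightarrow> 'h) \<Rightarrow> ('h \<Rightarrow> 'a \<Rightarrow> 'a)
      \<Rightarrow> ('m \<Rightarrow> 'h \<Rightarrow> 'm) \<Rightarrow> 'm::complex_vector \<otimes> 'a::complex_vector tensor_words \<Rightarrow> 'h
      \<Rightarrow> 'm \<otimes> 'a tensor_words"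
  where "coeff_ract \<Delta> \<epsilon> S act ract x h =
    tensor_lift (\<lambda>m t. tensor_lift (\<lambda>h\<^sub>1 h\<^sub>2. ract m h\<^sub>1 \<otimes> diag_act \<Delta> \<epsilon> act (S h\<^sub>2) t) (\<Delta> h)) x"

text \<open>\<open>C\<^sup>n\<^sub>H(A, M)\<close>: the \<open>H\<close>-linear maps from \<open>M \<otimes> A\<^bsup>\<otimes>(n+1)\<^esup>\<close> to the trivial module. Only
  their values on that subspace matter; outside of it they are unconstrained.\<close>

definition cochains ::
    "('h::complex_vector \<Rightarrow> 'h \<otimes> 'h) \<Rightarrow> ('h \<Rightarrow> complex) \<Rightarrow> ('h \<Rightarrow> 'h) \<Rightarrow> ('h \<Rightarrow> 'a \<Rightarrow> 'a)
      \<Rightarrow> ('m \<Rightarrow> 'h \<Rightarrow> 'm) \<Rightarrow> nat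
      \<Rightarrow> ('m::complex_vector \<otimes> 'a::complex_vector tensor_words \<Rightarrow> complex) set"
  where "cochains \<Delta> \<epsilon> S act ract n =
    {\<phi>. (\<forall>x\<in>coeff_tensor_power (n + 1). \<forall>y\<in>coeff_tensor_power (n + 1). \<phi> (x + y) = \<phi> x + \<phi> y) \<and>
        (\<forall>c. \<forall>x\<in>coeff_tensor_power (n + 1). \<phi> (c *\<^sub>C x) = c * \<phi> x) \<and>
        (\<forall>h. \<forall>x\<in>coeff_tensor_power (n + 1). \<phi> (coeff_ract \<Delta> \<epsilon> S act ract x h) = \<epsilon> h * \<phi> x)}"

text \<open>\<open>inv S\<close> is the inverse of the antipode, which is assumed to be bijective.\<close>

locale ah_sayd_module =
  module_algebra \<Delta> \<epsilon> S act + right_module ract + left_comodule \<Delta> \<epsilon> coact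
  for \<Delta> :: "'h::complex_unital_algebra \<Rightarrow> 'h \<otimes> 'h"
    and \<epsilon> :: "'h \<Rightarrow> complex"
    and S :: "'h \<Rightarrow> 'h"
    and act :: "'h \<Rightarrow> 'a::complex_unital_algebra \<Rightarrow> 'a"
    and ract :: "'m::complex_vector \<Rightarrow> 'h \<Rightarrow> 'm"
    and coact :: "'m \<Rightarrow> 'h \<otimes> 'm" +
  assumes antipode_bij: "bij S"
    and twisted_anti_yetter_drinfeld:
      "tensor_lift (\<lambda>k n. act (inv S k) a \<otimes> n) (coact (ract m h)) =
        tensor_lift (\<lambda>k n. sweedler3 \<Delta> (\<lambda>h\<^sub>1 h\<^sub>2 h\<^sub>3. act (inv S (k * h\<^sub>1) * h\<^sub>3) a \<otimes> ract n h\<^sub>2) h)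
          (coact m)"
    and cochain_stable:
      "\<phi> \<in> cochains \<Delta> \<epsilon> S act ract n \<Longrightarrow> t \<in> tensor_power (n + 1) \<Longrightarrow>
        \<phi> (tensor_lift (\<lambda>k m'. m' \<otimes> diag_act \<Delta> \<epsilon> act (inv S k) t) (coact m)) = \<phi> (m \<otimes> t)"

end

theory Submission
  imports Defs
begin

text \<open>Write \<open>S\<inverse>\<close> for \<open>inv S\<close>. Both conditions are consequences of the anti-multiplicativity of the
  antipode (\<open>antipode_mult\<close>) and of the two antipode identities.

  The twisted anti Yetter--Drinfeld condition is the image of the original one under
  \<open>k \<otimes> n \<mapsto> S\<inverse>(k) a \<otimes> n\<close>, because \<open>S\<inverse>(S(h\<^sup>3) k h\<^sup>1) = S\<inverse>(k h\<^sup>1) h\<^sup>3\<close> (\<open>inv_antipode_mult\<close>).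

  For the stability of cochains, invariance lets one move the action from one tensor factor to the
  other: \<open>\<phi>(m k \<otimes> t) = \<phi>(m k\<^sup>1 \<otimes> S(k\<^sup>2) k\<^sup>3 t) = \<phi>(m \<otimes> k t)\<close>, where the second step is the invariance of
  \<open>\<phi>\<close> with respect to \<open>k\<^sup>1\<close> (\<open>cochain_balanced\<close>). Hence it remains to see
  \<open>m\<^sub>0 S\<inverse>(m\<^sub>-\<^sub>1) = m\<close> (\<open>stable_inv_antipode\<close>). Stability of \<open>M\<close> applied to \<open>m\<^sub>0\<close>, followed by
  coassociativity, gives \<open>m\<^sub>0 S\<inverse>(m\<^sub>-\<^sub>1) = m\<^sub>0 m\<^sub>-\<^sub>1 S\<inverse>(m\<^sub>-\<^sub>2)\<close>, and the product
  \<open>k\<^sup>2 S\<inverse>(k\<^sup>1)\<close> collapses to \<open>\<epsilon>(k)\<close> (\<open>inv_antipode_right\<close>).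

  Sweedler sums are iterated applications of \<open>tensor_lift\<close>. A computation with them consists
  of moving linear maps through \<open>tensor_lift\<close> (\<open>clinear_tensor_lift_apply\<close>), of rebracketing
  (\<open>comult_coassoc\<close>) and of cancelling counits; the multilinearity side conditions are left to
  the simplifier.\<close>


section \<open>Multilinear calculus\<close>

lemma clinear_iff: "clinear f \<longleftrightarrow> (\<forall>x y. f (x + y) = f x + f y) \<and> (\<forall>c x. f (c *\<^sub>C x) = c *\<^sub>C f x)"
  by (auto simp: clinear_add clinear_scaleC intro: clinearI)

lemma cbilinear_iff:
  "cbilinear f \<longleftrightarrow>
    (\<forall>x y z. f (x + y) z = f x z + f y z) \<and> (\<forall>c x z. f (c *\<^sub>C x) z = c *\<^sub>C f x z) \<and>
    (\<forall>x y z. f x (y + z) = f x y + f x z) \<and> (\<forall>c x z. f x (c *\<^sub>C z) = c *\<^sub>C f x z)"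
  by (auto simp: cbilinear_def clinear_iff)

lemma tensor_lift_add:
  "cbilinear f \<Longrightarrow> cbilinear g \<Longrightarrow>
    tensor_lift (\<lambda>x y. f x y + g x y) t = tensor_lift f t + tensor_lift g t"
  by (induction t rule: tensor_induct)
    (simp_all add: clinear_add[OF clinear_tensor_lift] tensor_lift_tensor cbilinear_iff
      scaleC_add_right algebra_simps)

lemma tensor_lift_scaleC:
  assumes "cbilinear f"
  shows "tensor_lift (\<lambda>x y. c *\<^sub>C f x y) t = c *\<^sub>C tensor_lift f t"
proof -
  have "cbilinear (\<lambda>x y. c *\<^sub>C f x y)"
    using assms by (simp add: cbilinear_iff scaleC_add_right scaleC_scaleC mult.commute)
  with assms show ?thesis
    by (induction t rule: tensor_induct)
      (simp_all add: clinear_add[OF clinear_tensor_lift] tensor_lift_tensor scaleC_add_right)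
qed

lemma clinear_tensor_lift_apply:
  assumes "clinear g" "cbilinear f"
  shows "g (tensor_lift f t) = tensor_lift (\<lambda>x y. g (f x y)) t"
proof -
  have "cbilinear (\<lambda>x y. g (f x y))"
    using assms by (simp add: cbilinear_iff clinear_iff)
  with assms show ?thesis
    by (induction t rule: tensor_induct)
      (simp_all add: clinear_add clinear_tensor_lift tensor_lift_tensor)
qed

text \<open>These rules reduce a multilinearity claim about nested \<open>tensor_lift\<close> expressions to the
  additivity and homogeneity of the maps at the leaves: the bilinearity premises of
  \<open>tensor_lift_add\<close> and \<open>tensor_lift_scaleC\<close> are discharged by the same rules.\<close>

lemmas multilinear_simps =
  clinear_iff cbilinear_iff tensor_simps tensor_lift_add tensor_lift_scaleC
  clinear_add[OF clinear_tensor_lift] clinear_scaleC[OF clinear_tensor_lift]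
  scaleC_add_left scaleC_add_right scaleC_scaleC mult_scaleC_left mult_scaleC_right
  distrib_left distrib_right ac_simps

text \<open>Fubini for Sweedler sums: both sides are linear in \<open>s\<close>, and for an elementary tensor
  \<open>s = x \<otimes> y\<close> both are \<open>tensor_lift (F x y) t\<close>.\<close>

lemma tensor_lift_swap:
  assumes "\<And>c d. cbilinear (\<lambda>a b. F a b c d)" "\<And>a b. cbilinear (F a b)"
  shows "tensor_lift (\<lambda>a b. tensor_lift (F a b) t) s =
    tensor_lift (\<lambda>c d. tensor_lift (\<lambda>a b. F a b c d) s) t"
proof -
  have F: "cbilinear (F a b)" "cbilinear (\<lambda>a b. F a b c d)"
    for a b c d using assms by simp_all
  \<comment> \<open>Stated as equations between functions, since \<open>F (a + a') b\<close> occurs unapplied under \<open>tensor_lift\<close>.\<close>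
  have F': "F (a + a') b = (\<lambda>c d. F a b c d + F a' b c d)"
    "F a (b + b') = (\<lambda>c d. F a b c d + F a b' c d)"
    "F a b (c + c') d = F a b c d + F a b c' d" "F a b c (d + d') = F a b c d + F a b c d'"
    "F (z *\<^sub>C a) b = (\<lambda>c d. z *\<^sub>C F a b c d)" "F a (z *\<^sub>C b) = (\<lambda>c d. z *\<^sub>C F a b c d)"
    "F a b (z *\<^sub>C c) d = z *\<^sub>C F a b c d" "F a b c (z *\<^sub>C d) = z *\<^sub>C F a b c d"
    for a a' b b' c c' d d' z
    by (intro ext cbilinearD(3-)[OF F(1)] cbilinearD(3-)[OF F(2)])+
  show ?thesis
  proof (induction s rule: tensor_induct)
    case (tensor x y)
    have "cbilinear (\<lambda>a b. tensor_lift (F a b) t)"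
      using F' by (simp add: multilinear_simps)
    with F(2) show ?case
      by (simp add: tensor_lift_tensor)
  next
    case (add s s')
    then show ?case
      using F' by (simp add: multilinear_simps)
  qed
qed

text \<open>Rebracketing a threefold Sweedler sum. The hypothesis covers both the coassociativity of a
  comultiplication (\<open>f = g = \<Delta>\<close>) and that of a left coaction (\<open>f = \<Delta>\<close>, \<open>g\<close> the coaction).
  The trilinear map \<open>F\<close> factors through a linear map \<open>?L\<close> on the right-nested triple tensor
  product, and \<open>?L\<close> is applied to both sides.\<close>

lemma tensor_lift_coassoc:
  assumes coassoc: "tensor_assoc (tensor_map f id t) = tensor_map id g t"
    and "clinear f" "clinear g"
    and "\<And>y z. clinear (\<lambda>x. F x y z)" "\<And>x z. clinear (\<lambda>y. F x y z)" "\<And>x y. clinear (F x y)"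
  shows "tensor_lift (\<lambda>k z. tensor_lift (\<lambda>x y. F x y z) (f k)) t =
    tensor_lift (\<lambda>x w. tensor_lift (F x) (g w)) t"
proof -
  note lin = assms(2-)[unfolded clinear_iff]
  let ?L = "tensor_lift (\<lambda>x. tensor_lift (F x))"
  have F: "F (x + x') = (\<lambda>y z. F x y z + F x' y z)" "F (c *\<^sub>C x) = (\<lambda>y z. c *\<^sub>C F x y z)" for x x' c
    using lin by (intro ext, simp)+
  have bil: "cbilinear (\<lambda>x. tensor_lift (F x))"
    using lin F by (simp add: multilinear_simps)
  have L: "clinear ?L"
    by (rule clinear_tensor_lift[OF bil])
  have assoc_bil: "cbilinear (\<lambda>s z. tensor_lift (\<lambda>x y. x \<otimes> y \<otimes> z) s)"
    by (simp add: multilinear_simps)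
  have "tensor_assoc (tensor_map f id t) =
      tensor_lift (\<lambda>k z. tensor_lift (\<lambda>x y. x \<otimes> y \<otimes> z) (f k)) t"
    unfolding tensor_assoc_def tensor_map_def using lin
    by (subst clinear_tensor_lift_apply[OF clinear_tensor_lift[OF assoc_bil]])
      (simp_all add: multilinear_simps tensor_lift_tensor[OF assoc_bil])
  moreover have "?L (tensor_lift (\<lambda>x y. x \<otimes> y \<otimes> z) s) = tensor_lift (\<lambda>x y. F x y z) s" for s z
    using lin
    by (subst clinear_tensor_lift_apply[OF L])
      (simp_all add: tensor_lift_tensor[OF bil] tensor_lift_tensor multilinear_simps)
  ultimately have "?L (tensor_assoc (tensor_map f id t)) =
      tensor_lift (\<lambda>k z. tensor_lift (\<lambda>x y. F x y z) (f k)) t"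
    using lin by (simp add: clinear_tensor_lift_apply[OF L] multilinear_simps)
  moreover have "?L (tensor_map id g t) = tensor_lift (\<lambda>x w. tensor_lift (F x) (g w)) t"
    unfolding tensor_map_def using lin
    by (subst clinear_tensor_lift_apply[OF L])
      (simp_all add: multilinear_simps tensor_lift_tensor[OF bil])
  ultimately show ?thesis
    using coassoc by metis
qed

lemma tensor_lift_in_subspace:
  assumes "cbilinear f" "cvec.subspace V" "\<And>x y. f x y \<in> V"
  shows "tensor_lift f t \<in> V"
  by (induction t rule: tensor_induct)
    (simp_all add: assms tensor_lift_tensor clinear_add[OF clinear_tensor_lift]
      cvec.subspace_add)

lemma tensor_lift_mult:
  assumes "cbilinear f"
  shows "tensor_lift f (s * t) =
    tensor_lift (\<lambda>a b. tensor_lift (\<lambda>a' b'. f (a * a') (b * b')) t) s"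
proof -
  note f = cbilinearD(3-)[OF assms]
  have "cbilinear (\<lambda>a' b'. f (a * a') (b * b'))" for a b
    by (simp add: multilinear_simps f)
  then show ?thesis
    unfolding times_tensor_def
    by (simp add: multilinear_simps f clinear_tensor_lift_apply[OF clinear_tensor_lift[OF assms]]
      tensor_lift_tensor[OF assms])
qed

text \<open>A cochain is linear only on \<open>M \<otimes> A\<^bsup>\<otimes>(n+1)\<^esup>\<close>, inside the larger space \<open>M \<otimes> T(A)\<close>. Replacing it by a
  globally linear map with the same values there makes it composable with \<open>tensor_lift\<close>.\<close>

lemma linear_on_subspace_extends:
  fixes f :: "'v::complex_vector \<Rightarrow> 'w::complex_vector"
  assumes V: "cvec.subspace V"
    and add: "\<And>x y. x \<in> V \<Longrightarrow> y \<in> V \<Longrightarrow> f (x + y) = f x + f y"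
    and scale: "\<And>c x. x \<in> V \<Longrightarrow> f (c *\<^sub>C x) = c *\<^sub>C f x"
  obtains g where "clinear g" "\<And>x. x \<in> V \<Longrightarrow> g x = f x"
proof -
  interpret vector_space_pair "scaleC :: complex \<Rightarrow> 'v \<Rightarrow> 'v" "scaleC :: complex \<Rightarrow> 'w \<Rightarrow> 'w" ..
  obtain B where B: "B \<subseteq> V" "cvec.independent B" "V \<subseteq> cspan B"
    using cvec.maximal_independent_subset by blast
  obtain g where g: "clinear g" "\<forall>x\<in>B. g x = f x"
    using linear_independent_extend[OF B(2)] by blast
  have "x \<in> V \<and> g x = f x" if "x \<in> cspan B" for x
    using that
  proof (induction rule: cvec.span_induct_alt)
    case base
    show ?case
      using scale[of 0 0] by (simp add: cvec.subspace_0[OF V] clinear_0[OF g(1)])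
  next
    case (step c x y)
    then have "x \<in> V" "c *\<^sub>C x \<in> V"
      using B(1) cvec.subspace_scale[OF V] by auto
    with step show ?case
      using g by (simp add: cvec.subspace_add[OF V] clinear_add clinear_scaleC add scale)
  qed
  with that[of g] g B(3) show ?thesis
    by blast
qed


section \<open>The antipode and its inverse\<close>

lemmas (in coalgebra) coalgebra_linear =
  comult_linear[unfolded clinear_iff] counit_linear[unfolded clinear_iff]

lemma (in coalgebra) comult_coassoc:
  assumes "\<And>y z. clinear (\<lambda>x. F x y z)" "\<And>x z. clinear (\<lambda>y. F x y z)" "\<And>x y. clinear (F x y)"
  shows "tensor_lift (\<lambda>k z. tensor_lift (\<lambda>x y. F x y z) (\<Delta> k)) (\<Delta> h) =
    tensor_lift (\<lambda>x w. tensor_lift (F x) (\<Delta> w)) (\<Delta> h)"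
  by (rule tensor_lift_coassoc[OF coassoc comult_linear comult_linear assms])

lemma (in coalgebra) counit_left_apply:
  assumes "clinear G"
  shows "tensor_lift (\<lambda>x y. \<epsilon> x *\<^sub>C G y) (\<Delta> h) = G h"
proof -
  have "G h = G (tensor_lift (\<lambda>x y. \<epsilon> x *\<^sub>C y) (\<Delta> h))"
    by (simp add: counit_left)
  also have "\<dots> = tensor_lift (\<lambda>x y. \<epsilon> x *\<^sub>C G y) (\<Delta> h)"
    using assms coalgebra_linear
    by (subst clinear_tensor_lift_apply) (simp_all add: multilinear_simps scaleC_complex_def)
  finally show ?thesis by simp
qed

lemma (in coalgebra) counit_right_apply:
  assumes "clinear G"
  shows "tensor_lift (\<lambda>x y. \<epsilon> y *\<^sub>C G x) (\<Delta> h) = G h"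
proof -
  have "G h = G (tensor_lift (\<lambda>x y. \<epsilon> y *\<^sub>C x) (\<Delta> h))"
    by (simp add: counit_right)
  also have "\<dots> = tensor_lift (\<lambda>x y. \<epsilon> y *\<^sub>C G x) (\<Delta> h)"
    using assms coalgebra_linear
    by (subst clinear_tensor_lift_apply) (simp_all add: multilinear_simps scaleC_complex_def)
  finally show ?thesis by simp
qed

lemmas (in hopf_algebra) hopf_linear = coalgebra_linear antipode_linear[unfolded clinear_iff]

text \<open>The antipode is the unique right convolution inverse of the identity, here with a constant
  \<open>c\<close> carried along: \<open>G(x) = S(x\<^sup>1) x\<^sup>2 G(x\<^sup>3) = S(x\<^sup>1) \<epsilon>(x\<^sup>2) c\<close>.\<close>

lemma (in hopf_algebra) antipode_cancel:
  assumes "clinear G" and eq: "\<And>x. tensor_lift (\<lambda>x\<^sub>1 x\<^sub>2. x\<^sub>1 * G x\<^sub>2) (\<Delta> x) = \<epsilon> x *\<^sub>C c"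
  shows "G x = S x * c"
proof -
  note lin = hopf_linear assms(1)[unfolded clinear_iff]
  have "G x = tensor_lift (\<lambda>x\<^sub>1 x\<^sub>2. \<epsilon> x\<^sub>1 *\<^sub>C G x\<^sub>2) (\<Delta> x)"
    by (simp add: counit_left_apply[OF assms(1)])
  also have "\<dots> = tensor_lift (\<lambda>k x\<^sub>3. tensor_lift (\<lambda>x\<^sub>1 x\<^sub>2. S x\<^sub>1 * x\<^sub>2) (\<Delta> k) * G x\<^sub>3) (\<Delta> x)"
    by (simp add: antipode_left mult_scaleC_left)
  also have "\<dots> = tensor_lift (\<lambda>k x\<^sub>3. tensor_lift (\<lambda>x\<^sub>1 x\<^sub>2. S x\<^sub>1 * (x\<^sub>2 * G x\<^sub>3)) (\<Delta> k)) (\<Delta> x)"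
    using lin
    by (subst clinear_tensor_lift_apply[where g = "\<lambda>u. u * G _"])
      (simp_all add: multilinear_simps)
  also have "\<dots> = tensor_lift (\<lambda>x\<^sub>1 w. tensor_lift (\<lambda>x\<^sub>2 x\<^sub>3. S x\<^sub>1 * (x\<^sub>2 * G x\<^sub>3)) (\<Delta> w)) (\<Delta> x)"
    using lin by (intro comult_coassoc) (simp_all add: multilinear_simps)
  also have "\<dots> = tensor_lift (\<lambda>x\<^sub>1 w. S x\<^sub>1 * tensor_lift (\<lambda>x\<^sub>2 x\<^sub>3. x\<^sub>2 * G x\<^sub>3) (\<Delta> w)) (\<Delta> x)"
    using lin
    by (subst clinear_tensor_lift_apply[where g = "\<lambda>u. S _ * u"]) (simp_all add: multilinear_simps)
  also have "\<dots> = tensor_lift (\<lambda>x\<^sub>1 w. \<epsilon> w *\<^sub>C (S x\<^sub>1 * c)) (\<Delta> x)"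
    by (simp add: eq mult_scaleC_right)
  also have "\<dots> = S x * c"
    using lin by (intro counit_right_apply) (simp add: multilinear_simps)
  finally show ?thesis .
qed

text \<open>Starting from \<open>g\<^sup>1 h\<^sup>1 S(g\<^sup>2 h\<^sup>2) = \<epsilon>(g) \<epsilon>(h)\<close>, cancel first \<open>g\<^sup>1\<close> and then \<open>h\<^sup>1\<close> with
  \<open>antipode_cancel\<close>; treating the variables one at a time avoids the coalgebra structure of \<open>H \<otimes> H\<close>.\<close>

lemma (in hopf_algebra) antipode_mult: "S (g * h) = S h * S g"
proof -
  note lin = hopf_linear
  have inner: "tensor_lift (\<lambda>h\<^sub>1 h\<^sub>2. h\<^sub>1 * S (g * h\<^sub>2)) (\<Delta> h) = S g * (\<epsilon> h *\<^sub>C 1)" for g h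
  proof (rule antipode_cancel)
    show "clinear (\<lambda>g. tensor_lift (\<lambda>h\<^sub>1 h\<^sub>2. h\<^sub>1 * S (g * h\<^sub>2)) (\<Delta> h))"
      using lin by (simp add: multilinear_simps)
    fix x
    have "tensor_lift (\<lambda>x\<^sub>1 x\<^sub>2. x\<^sub>1 * tensor_lift (\<lambda>h\<^sub>1 h\<^sub>2. h\<^sub>1 * S (x\<^sub>2 * h\<^sub>2)) (\<Delta> h)) (\<Delta> x) =
      tensor_lift (\<lambda>x\<^sub>1 x\<^sub>2. tensor_lift (\<lambda>h\<^sub>1 h\<^sub>2. (x\<^sub>1 * h\<^sub>1) * S (x\<^sub>2 * h\<^sub>2)) (\<Delta> h)) (\<Delta> x)"
      using lin
      by (subst clinear_tensor_lift_apply[where g = "\<lambda>u. _ * u"]) (simp_all add: multilinear_simps)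
    also have "\<dots> = tensor_lift (\<lambda>u v. u * S v) (\<Delta> (x * h))"
      unfolding comult_mult using lin by (subst tensor_lift_mult) (simp_all add: multilinear_simps)
    also have "\<dots> = \<epsilon> x *\<^sub>C (\<epsilon> h *\<^sub>C 1)"
      by (simp add: antipode_right counit_mult scaleC_scaleC)
    finally show "tensor_lift (\<lambda>x\<^sub>1 x\<^sub>2. x\<^sub>1 * tensor_lift (\<lambda>h\<^sub>1 h\<^sub>2. h\<^sub>1 * S (x\<^sub>2 * h\<^sub>2)) (\<Delta> h)) (\<Delta> x) =
      \<epsilon> x *\<^sub>C (\<epsilon> h *\<^sub>C 1)" .
  qed
  show ?thesis
    using lin by (intro antipode_cancel[where G = "\<lambda>h. S (g * h)"])
      (simp_all add: inner multilinear_simps)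
qed

lemma (in hopf_algebra) antipode_one: "S 1 = 1"
proof -
  have "cbilinear (\<lambda>x y. S x * y)"
    using hopf_linear by (simp add: multilinear_simps)
  with antipode_left[of 1] show ?thesis
    by (simp add: comult_one one_tensor_def tensor_lift_tensor counit_one scaleC_one)
qed

context hopf_algebra
begin

context
  assumes bij: "bij S"
begin

lemma antipode_inv: "S (inv S x) = x"
  using bij by (simp add: bij_is_surj surj_f_inv_f)

lemma inv_antipode: "inv S (S x) = x"
  using bij by (simp add: bij_is_inj)

lemma inv_antipode_eqI: "S y = x \<Longrightarrow> inv S x = y"
  using inv_antipode by blast

lemma clinear_inv_antipode: "clinear (inv S)"
  by (rule clinearI; rule inv_antipode_eqI)
    (use hopf_linear in \<open>simp_all add: antipode_inv\<close>)

lemma inv_antipode_mult: "inv S (S x * y) = inv S y * x"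
  by (rule inv_antipode_eqI) (simp add: antipode_mult antipode_inv)

text \<open>The image under \<open>S\<close> is \<open>h\<^sup>1 S(h\<^sup>2) = \<epsilon>(h)\<close>. As \<open>S\<close> reverses products, the legs appear in the
  opposite order.\<close>

lemma inv_antipode_right: "tensor_lift (\<lambda>x y. y * inv S x) (\<Delta> h) = \<epsilon> h *\<^sub>C 1"
proof -
  note lin = hopf_linear clinear_inv_antipode[unfolded clinear_iff]
  have "S (tensor_lift (\<lambda>x y. y * inv S x) (\<Delta> h)) = tensor_lift (\<lambda>x y. x * S y) (\<Delta> h)"
    using lin by (subst clinear_tensor_lift_apply[OF antipode_linear])
      (simp_all add: multilinear_simps antipode_mult antipode_inv)
  also have "\<dots> = S (\<epsilon> h *\<^sub>C 1)"
    using hopf_linear by (simp add: antipode_right antipode_one)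
  finally show ?thesis
    by (metis inv_antipode)
qed

end

end


section \<open>The diagonal action\<close>

lemma words_cons_add_right: "words_cons a (s + t) = words_cons a s + words_cons a t"
  and words_cons_scaleC_right: "words_cons a (c *\<^sub>C t) = c *\<^sub>C words_cons a t"
  using clinear_words_lift[OF cmultilinear_word_Cons, of a]
  by (simp_all add: words_cons_def clinear_iff)

lemma word_Cons_linear:
  "word ((a + b) # as) = word (a # as) + word (b # as)"
  "word ((c *\<^sub>C a) # as) = c *\<^sub>C word (a # as)"
  using cmultilinear_word[unfolded cmultilinear_def clinear_iff, THEN spec[of _ "[]"], THEN spec[of _ as]]
  by simp_all

lemma words_cons_add_left: "words_cons (a + b) t = words_cons a t + words_cons b t"
proof -
  have "words_cons (a + b) = (\<lambda>t. words_cons a t + words_cons b t)"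
    by (intro words_clinear_eqI)
      (auto simp: clinear_iff words_cons_add_right words_cons_scaleC_right scaleC_add_right
        words_cons_word word_Cons_linear)
  then show ?thesis by simp
qed

lemma words_cons_scaleC_left: "words_cons (c *\<^sub>C a) t = c *\<^sub>C words_cons a t"
proof -
  have "words_cons (c *\<^sub>C a) = (\<lambda>t. c *\<^sub>C words_cons a t)"
    by (intro words_clinear_eqI)
      (auto simp: clinear_iff words_cons_add_right words_cons_scaleC_right scaleC_add_right
        words_cons_word word_Cons_linear scaleC_scaleC mult.commute)
  then show ?thesis by simp
qed

lemmas words_cons_simps =
  words_cons_add_left words_cons_add_right words_cons_scaleC_left words_cons_scaleC_right

lemma words_cons_tensor_power: "t \<in> tensor_power n \<Longrightarrow> words_cons a t \<in> tensor_power (Suc n)"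
  unfolding tensor_power_def
proof (induction rule: cvec.span_induct_alt)
  case base
  have "words_cons a 0 = 0"
    using words_cons_scaleC_right[of a 0 0] by simp
  then show ?case
    by (simp add: cvec.span_zero)
next
  case (step c x y)
  then have "words_cons a x \<in> cspan {word as | as. length as = Suc n}"
    by (force simp: words_cons_word intro: cvec.span_base)
  with step show ?case
    by (simp add: words_cons_simps cvec.span_add cvec.span_scale)
qed

lemmas (in left_module) act_linear = act_bilinear[unfolded cbilinear_iff]
lemmas (in right_module) ract_linear = ract_bilinear[unfolded cbilinear_iff]

context module_algebra
begin

abbreviation "dact_word \<equiv> diag_act_word \<Delta> \<epsilon> act"
abbreviation "dact \<equiv> diag_act \<Delta> \<epsilon> act"

lemma diag_act_word_linear: "clinear (dact_word as)"
  using hopf_linear act_linear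
  by (induction as) (simp_all add: multilinear_simps words_cons_simps scaleC_complex_def)

lemma cmultilinear_diag_act_word: "cmultilinear (\<lambda>as. dact_word as h)"
  unfolding cmultilinear_def
proof (intro allI)
  fix u v
  show "clinear (\<lambda>x. dact_word (u @ x # v) h)"
    using hopf_linear act_linear diag_act_word_linear
    by (induction u arbitrary: h) (simp_all add: multilinear_simps words_cons_simps)
qed

lemma diag_act_word: "dact h (word as) = dact_word as h"
  unfolding diag_act_def by (rule words_lift_word[OF cmultilinear_diag_act_word])

lemma diag_act_linear_right: "clinear (dact h)"
  unfolding diag_act_def by (rule clinear_words_lift[OF cmultilinear_diag_act_word])

lemma diag_act_bilinear: "cbilinear dact"
proof -
  note lin = diag_act_linear_right[unfolded clinear_iff] diag_act_word_linear[unfolded clinear_iff]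
  have "dact (g + h) = (\<lambda>t. dact g t + dact h t)" for g h
    using lin by (intro words_clinear_eqI) (simp_all add: multilinear_simps diag_act_word)
  moreover have "dact (c *\<^sub>C h) = (\<lambda>t. c *\<^sub>C dact h t)" for c h
    using lin by (intro words_clinear_eqI) (simp_all add: multilinear_simps diag_act_word)
  ultimately show ?thesis
    using lin by (simp add: multilinear_simps)
qed

lemmas diag_act_linear = diag_act_bilinear[unfolded cbilinear_iff]

lemma diag_act_words_cons:
  "dact h (words_cons a t) = tensor_lift (\<lambda>h\<^sub>1 h\<^sub>2. words_cons (act h\<^sub>1 a) (dact h\<^sub>2 t)) (\<Delta> h)"
proof -
  note lin = diag_act_linear act_linear hopf_linear
  have "(\<lambda>t. dact h (words_cons a t)) =
      (\<lambda>t. tensor_lift (\<lambda>h\<^sub>1 h\<^sub>2. words_cons (act h\<^sub>1 a) (dact h\<^sub>2 t)) (\<Delta> h))"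
    using lin
    by (intro words_clinear_eqI)
      (simp_all add: multilinear_simps words_cons_simps words_cons_word diag_act_word)
  then show ?thesis by metis
qed

text \<open>The diagonal action is again an action, by induction on the length of a word: \<open>\<Delta>\<close> is
  multiplicative, and the sums over \<open>\<Delta> g\<close> and \<open>\<Delta> h\<close> have to be exchanged.\<close>

lemma diag_act_mult: "dact (g * h) t = dact g (dact h t)"
proof -
  note lin = diag_act_linear act_linear hopf_linear
  have "dact (g * h) (word as) = dact g (dact h (word as))" for as
  proof (induction as arbitrary: g h)
    case Nil
    then show ?case
      using lin by (simp add: diag_act_word counit_mult scaleC_scaleC mult.commute)
  next
    case (Cons a as)
    let ?F = "\<lambda>g\<^sub>1 g\<^sub>2 h\<^sub>1 h\<^sub>2. words_cons (act g\<^sub>1 (act h\<^sub>1 a)) (dact g\<^sub>2 (dact h\<^sub>2 (word as)))"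
    have "dact (g * h) (word (a # as)) =
        tensor_lift (\<lambda>x y. words_cons (act x a) (dact y (word as))) (\<Delta> g * \<Delta> h)"
      by (simp add: words_cons_word[symmetric] diag_act_words_cons comult_mult)
    also have "\<dots> = tensor_lift (\<lambda>g\<^sub>1 g\<^sub>2. tensor_lift (?F g\<^sub>1 g\<^sub>2) (\<Delta> h)) (\<Delta> g)"
      using lin
      by (subst tensor_lift_mult) (simp_all add: multilinear_simps words_cons_simps Cons act_mult)
    also have "\<dots> = tensor_lift (\<lambda>h\<^sub>1 h\<^sub>2. tensor_lift (\<lambda>g\<^sub>1 g\<^sub>2. ?F g\<^sub>1 g\<^sub>2 h\<^sub>1 h\<^sub>2) (\<Delta> g)) (\<Delta> h)"
      using lin by (intro tensor_lift_swap) (simp_all add: multilinear_simps words_cons_simps)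
    also have "\<dots> = tensor_lift (\<lambda>h\<^sub>1 h\<^sub>2. dact g (words_cons (act h\<^sub>1 a) (dact h\<^sub>2 (word as)))) (\<Delta> h)"
      by (simp add: diag_act_words_cons)
    also have "\<dots> = dact g (tensor_lift (\<lambda>h\<^sub>1 h\<^sub>2. words_cons (act h\<^sub>1 a) (dact h\<^sub>2 (word as))) (\<Delta> h))"
      using lin
      by (subst clinear_tensor_lift_apply[OF diag_act_linear_right])
        (simp_all add: multilinear_simps words_cons_simps)
    also have "\<dots> = dact g (dact h (word (a # as)))"
      by (simp add: words_cons_word[symmetric] diag_act_words_cons)
    finally show ?case .
  qed
  then have "dact (g * h) = (\<lambda>t. dact g (dact h t))"
    using lin by (intro words_clinear_eqI) (simp_all add: multilinear_simps)
  then show ?thesis by metis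
qed

lemma diag_act_one: "dact 1 t = t"
proof -
  note lin = diag_act_linear act_linear hopf_linear
  have "dact 1 (word as) = word as" for as
  proof (induction as)
    case Nil
    then show ?case by (simp add: diag_act_word counit_one scaleC_one)
  next
    case (Cons a as)
    have "cbilinear (\<lambda>x y. words_cons (act x a) (dact y (word as)))"
      using lin by (simp add: multilinear_simps words_cons_simps)
    with Cons show ?case
      by (simp add: words_cons_word[symmetric] diag_act_words_cons comult_one one_tensor_def
          tensor_lift_tensor act_one)
  qed
  then have "dact 1 = (\<lambda>t. t)"
    using lin by (intro words_clinear_eqI) (simp_all add: multilinear_simps)
  then show ?thesis by metis
qed

lemma diag_act_tensor_power:
  assumes "t \<in> tensor_power n"
  shows "dact h t \<in> tensor_power n"
proof -
  note lin = diag_act_linear act_linear hopf_linear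
  have sub: "cvec.subspace (tensor_power n)" for n
    by (simp add: tensor_power_def cvec.subspace_span)
  have word: "dact h (word as) \<in> tensor_power (length as)" for h as
  proof (induction as arbitrary: h)
    case Nil
    have "word [] \<in> tensor_power 0"
      by (simp add: tensor_power_def cvec.span_base)
    then show ?case
      using cvec.subspace_scale[OF sub] by (simp add: diag_act_word)
  next
    case (Cons a as)
    have "cbilinear (\<lambda>x y. words_cons (act x a) (dact y (word as)))"
      using lin by (simp add: multilinear_simps words_cons_simps)
    then show ?case
      by (simp add: words_cons_word[symmetric] diag_act_words_cons tensor_lift_in_subspace sub
          words_cons_tensor_power Cons)
  qed
  from assms show ?thesis
    unfolding tensor_power_def[of n]
  proof (induction rule: cvec.span_induct_alt)
    case base
    show ?case
      by (simp add: clinear_0[OF diag_act_linear_right] cvec.span_zero)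
  next
    case (step c x y)
    then have "dact h x \<in> tensor_power n" using word by auto
    with step show ?case
      using lin by (simp add: cvec.span_add cvec.span_scale tensor_power_def)
  qed
qed

end


section \<open>Invariant cochains and stability\<close>

text \<open>Invariant functionals are balanced over \<open>H\<close>. The computation runs through
  \<open>\<psi>(m \<otimes> k t) = \<psi>(m k\<^sup>1 \<otimes> S(k\<^sup>2) k\<^sup>3 t)\<close>, reached from the left by
  invariance under \<open>k\<^sup>1\<close>, with \<open>k\<^sup>2 t\<close> in place of \<open>t\<close>, and from the right by the antipode
  identity. The map \<open>\<psi>\<close> is a linear extension of the cochain \<open>\<phi>\<close>; invariance may be used because the diagonal action preserves \<open>A\<^bsup>\<otimes>(n+1)\<^esup>\<close>.\<close>

lemma (in module_algebra) cochain_balanced: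
  assumes "right_module ract" and \<phi>: "\<phi> \<in> cochains \<Delta> \<epsilon> S act ract n" 
    and t: "t \<in> tensor_power (n + 1)"
    and \<psi>: "clinear \<psi>" "\<And>x. x \<in> coeff_tensor_power (n + 1) \<Longrightarrow> \<psi> x = \<phi> x"
  shows "\<psi> (m \<otimes> dact k t) = \<psi> (ract m k \<otimes> t)"
proof -
  interpret right_module ract by fact
  note lin = diag_act_linear hopf_linear ract_linear \<psi>(1)[unfolded clinear_iff]
  let ?C = "coeff_tensor_power (n + 1)"
  have sub: "cvec.subspace ?C"
    by (simp add: coeff_tensor_power_def cvec.subspace_span)
  have mem: "m \<otimes> s \<in> ?C" if "s \<in> tensor_power (n + 1)" for m s
    using that by (auto simp: coeff_tensor_power_def intro: cvec.span_base)
  have inv: "tensor_lift (\<lambda>x y. \<psi> (ract m x \<otimes> dact (S y) s)) (\<Delta> h) = \<epsilon> h *\<^sub>C \<psi> (m \<otimes> s)"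
    if s: "s \<in> tensor_power (n + 1)" for m s h
  proof -
    have bil: "cbilinear (\<lambda>x y. ract m x \<otimes> dact (S y) s)" for m s
      using lin by (simp add: multilinear_simps)
    have "cbilinear (\<lambda>m t. tensor_lift (\<lambda>x y. ract m x \<otimes> dact (S y) t) (\<Delta> h))"
      using lin by (simp add: multilinear_simps)
    then have eq: "coeff_ract \<Delta> \<epsilon> S act ract (m \<otimes> s) h =
        tensor_lift (\<lambda>x y. ract m x \<otimes> dact (S y) s) (\<Delta> h)"
      by (simp add: coeff_ract_def tensor_lift_tensor)
    have "tensor_lift (\<lambda>x y. ract m x \<otimes> dact (S y) s) (\<Delta> h) \<in> ?C"
      using s by (intro tensor_lift_in_subspace bil sub mem diag_act_tensor_power)
    then have "\<psi> (tensor_lift (\<lambda>x y. ract m x \<otimes> dact (S y) s) (\<Delta> h)) = \<epsilon> h * \<psi> (m \<otimes> s)"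
      using \<phi> mem[OF s, of m] by (simp add: \<psi>(2) eq[symmetric] cochains_def)
    then show ?thesis
      by (simp add: clinear_tensor_lift_apply[OF \<psi>(1) bil] scaleC_complex_def)
  qed
  have "\<psi> (m \<otimes> dact k t) = tensor_lift (\<lambda>x y. \<epsilon> x *\<^sub>C \<psi> (m \<otimes> dact y t)) (\<Delta> k)"
    using lin by (subst counit_left_apply) (simp_all add: multilinear_simps)
  also have "\<dots> = tensor_lift (\<lambda>u z.
      tensor_lift (\<lambda>x y. \<psi> (ract m x \<otimes> dact (S y) (dact z t))) (\<Delta> u)) (\<Delta> k)"
    by (simp add: inv[OF diag_act_tensor_power[OF t]])
  also have "\<dots> = tensor_lift (\<lambda>x w.
      tensor_lift (\<lambda>y z. \<psi> (ract m x \<otimes> dact (S y) (dact z t))) (\<Delta> w)) (\<Delta> k)"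
    using lin by (intro comult_coassoc) (simp_all add: multilinear_simps)
  also have "\<dots> = tensor_lift (\<lambda>x w.
      \<psi> (ract m x \<otimes> dact (tensor_lift (\<lambda>y z. S y * z) (\<Delta> w)) t)) (\<Delta> k)"
    using lin by (subst clinear_tensor_lift_apply[where g = "\<lambda>u. \<psi> (ract m _ \<otimes> dact u t)"])
      (simp_all add: multilinear_simps diag_act_mult)
  also have "\<dots> = tensor_lift (\<lambda>x w. \<epsilon> w *\<^sub>C \<psi> (ract m x \<otimes> t)) (\<Delta> k)"
    using lin by (simp add: antipode_left diag_act_one tensor_simps)
  also have "\<dots> = \<psi> (ract m k \<otimes> t)"
    using lin by (subst counit_right_apply) (simp_all add: multilinear_simps)
  finally show ?thesis .
qed

text \<open>Stability turns each \<open>n\<close> into \<open>n\<^sub>0 n\<^sub>-\<^sub>1\<close>. After rebracketing, the coefficient acting on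
  the last leg is \<open>k\<^sup>2 S\<inverse>(k\<^sup>1) = \<epsilon>(k)\<close> with \<open>k = m\<^sub>-\<^sub>1\<close>.\<close>

lemma (in sayd_module) stable_inv_antipode:
  assumes "bij S"
  shows "tensor_lift (\<lambda>k n. ract n (inv S k)) (coact m) = m"
proof -
  note lin = hopf_linear ract_linear coact_linear[unfolded clinear_iff]
    clinear_inv_antipode[OF assms, unfolded clinear_iff]
  have "tensor_lift (\<lambda>k n. ract n (inv S k)) (coact m) =
      tensor_lift (\<lambda>k n. ract (tensor_lift (\<lambda>l p. ract p l) (coact n)) (inv S k)) (coact m)"
    by (simp add: stable)
  also have "\<dots> = tensor_lift (\<lambda>k n. tensor_lift (\<lambda>l p. ract p (l * inv S k)) (coact n)) (coact m)"
    using lin by (subst clinear_tensor_lift_apply[where g = "\<lambda>u. ract u _"])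
      (simp_all add: multilinear_simps ract_mult)
  also have "\<dots> = tensor_lift (\<lambda>u p. tensor_lift (\<lambda>k l. ract p (l * inv S k)) (\<Delta> u)) (coact m)"
    using lin
    by (intro tensor_lift_coassoc[OF coact_coassoc comult_linear coact_linear, symmetric])
      (simp_all add: multilinear_simps)
  also have "\<dots> = tensor_lift (\<lambda>u p. ract p (tensor_lift (\<lambda>k l. l * inv S k) (\<Delta> u))) (coact m)"
    using lin by (subst clinear_tensor_lift_apply[where g = "ract _"])
      (simp_all add: multilinear_simps)
  also have "\<dots> = m"
    using lin by (simp add: inv_antipode_right[OF assms] ract_one coact_counit)
  finally show ?thesis .
qed

theorem lemma2p16:
  fixes \<Delta> :: "'h::complex_unital_algebra \<Rightarrow> 'h \<otimes> 'h"
    and \<epsilon> :: "'h \<Rightarrow> complex"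
    and S :: "'h \<Rightarrow> 'h"
    and act :: "'h \<Rightarrow> 'a::complex_unital_algebra \<Rightarrow> 'a"
    and ract :: "'m::complex_vector \<Rightarrow> 'h \<Rightarrow> 'm"
    and coact :: "'m \<Rightarrow> 'h \<otimes> 'm"
  assumes "hopf_algebra \<Delta> \<epsilon> S"
    and "bij S"
    and "module_algebra \<Delta> \<epsilon> S act"
    and "sayd_module \<Delta> \<epsilon> S ract coact"
  shows "ah_sayd_module \<Delta> \<epsilon> S act ract coact"
proof -
  interpret A: module_algebra \<Delta> \<epsilon> S act by fact
  interpret M: sayd_module \<Delta> \<epsilon> S ract coact by fact
  note lin = A.hopf_linear A.act_linear M.ract_linear M.coact_linear[unfolded clinear_iff]
    A.diag_act_linear A.clinear_inv_antipode[OF \<open>bij S\<close>, unfolded clinear_iff]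
  show ?thesis
  proof unfold_locales
    show "bij S" by fact
  next
    fix a m h
    let ?G = "tensor_lift (\<lambda>k n. act (inv S k) a \<otimes> n) :: 'h \<otimes> 'm \<Rightarrow> 'a \<otimes> 'm"
    have bil: "cbilinear (\<lambda>k n. act (inv S k) a \<otimes> n)"
      using lin by (simp add: multilinear_simps)
    have G: "?G ((S z * (k * x)) \<otimes> n) = act (inv S (k * x) * z) a \<otimes> n" for x z k n
      by (simp add: tensor_lift_tensor[OF bil] A.inv_antipode_mult[OF \<open>bij S\<close>])
    show "?G (coact (ract m h)) =
      tensor_lift (\<lambda>k n. sweedler3 \<Delta>
        (\<lambda>h\<^sub>1 h\<^sub>2 h\<^sub>3. act (inv S (k * h\<^sub>1) * h\<^sub>3) a \<otimes> ract n h\<^sub>2) h) (coact m)"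
      unfolding M.anti_yetter_drinfeld sweedler3_def
      using lin
      by (simp add: clinear_tensor_lift_apply[OF clinear_tensor_lift[OF bil]] G
          multilinear_simps)
  next
    fix \<phi> n m and t :: "'a tensor_words"
    assume \<phi>: "\<phi> \<in> cochains \<Delta> \<epsilon> S act ract n" and t: "t \<in> tensor_power (n + 1)"
    let ?C = "coeff_tensor_power (n + 1) :: ('m \<otimes> 'a tensor_words) set"
    have sub: "cvec.subspace ?C"
      by (simp add: coeff_tensor_power_def cvec.subspace_span)
    have mem: "p \<otimes> s \<in> ?C" if "s \<in> tensor_power (n + 1)" for p s
      using that by (auto simp: coeff_tensor_power_def intro: cvec.span_base)
    obtain \<psi> where \<psi>: "clinear \<psi>" "\<And>x. x \<in> ?C \<Longrightarrow> \<psi> x = \<phi> x"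
      using \<phi> by (elim linear_on_subspace_extends[OF sub, of \<phi>, rotated 2])
        (auto simp: cochains_def scaleC_complex_def)
    note lin = lin \<psi>(1)[unfolded clinear_iff]
    have bil: "cbilinear (\<lambda>k p. p \<otimes> A.dact (inv S k) t)"
      using lin by (simp add: multilinear_simps)
    have balanced: "\<psi> (p \<otimes> A.dact k t) = \<psi> (ract p k \<otimes> t)" for p k
      by (rule A.cochain_balanced[OF M.right_module_axioms \<phi> t \<psi>])
    have "\<phi> (tensor_lift (\<lambda>k p. p \<otimes> A.dact (inv S k) t) (coact m)) =
        \<psi> (tensor_lift (\<lambda>k p. p \<otimes> A.dact (inv S k) t) (coact m))"
      by (rule \<psi>(2)[symmetric])
        (intro tensor_lift_in_subspace bil sub mem A.diag_act_tensor_power t)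
    also have "\<dots> = tensor_lift (\<lambda>k p. \<psi> (ract p (inv S k) \<otimes> t)) (coact m)"
      by (simp add: clinear_tensor_lift_apply[OF \<psi>(1) bil] balanced)
    also have "\<dots> = \<psi> (tensor_lift (\<lambda>k p. ract p (inv S k)) (coact m) \<otimes> t)"
      using lin by (subst clinear_tensor_lift_apply[where g = "\<lambda>u. \<psi> (u \<otimes> t)"])
        (simp_all add: multilinear_simps)
    also have "\<dots> = \<phi> (m \<otimes> t)"
      by (simp add: M.stable_inv_antipode[OF \<open>bij S\<close>] \<psi>(2)[OF mem[OF t]])
    finally show "\<phi> (tensor_lift (\<lambda>k m'. m' \<otimes> A.dact (inv S k) t) (coact m)) = \<phi> (m \<otimes> t)" .
  qed
qed

end
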